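(* Let $F$ be a finite field, $\Gamma$ a nonempty set, $\varphi:\Gamma\to\Gamma$ a self-map, $\mathfrak{w}=(\mathfrak{w}_\alpha)_{\alpha\in\Gamma}\in F^\Gamma$, and let $\sigma_{\varphi,\mathfrak{w}}:F^\Gamma\to F^\Gamma$, $\sigma_{\varphi,\mathfrak{w}}((x_\alpha)_{\alpha\in\Gamma})=(\mathfrak{w}_\alpha x_{\varphi(\alpha)})_{\alpha\in\Gamma}$. The following statements are equivalent: 1. $\sigma_{\varphi,\mathfrak{w}}(\bigoplus_{\Gamma}F)\subseteq\bigoplus_{\Gamma}F$; 2. for each $\beta\in\Gamma$, $\sigma_{\varphi,\mathfrak{w}}(\mathsf{e}_\beta)\in\bigoplus_{\Gamma}F$; 3. $\varphi\restriction_{\mathrm{supp}(\mathfrak{w})}:\mathrm{supp}(\mathfrak{w})\to\Gamma$ is of finite fibre.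
   Context: For $x\in F^\Gamma$, $\mathrm{supp}(x)=\{\alpha\in\Gamma:x_\alpha\neq0\}$, and $\bigoplus_\Gamma F=\{x\in F^\Gamma:\mathrm{supp}(x)\text{ is finite}\}$. For $\beta\in\Gamma$, $\mathsf{e}_\beta\in F^\Gamma$ has $\beta$-th coordinate $1$ and all other coordinates $0$. A map $f:A\to B$ is of finite fibre if $f^{-1}(y)$ is finite for all $y\in B$. *)

theory Defs
  imports Main
begin

(* The index set Gamma is the universe of a type 'g, and F^Gamma is the function type
   'g => 'f; HOL types are nonempty, so Gamma is automatically nonempty. *)

definition supp :: "('g \<Rightarrow> 'f::zero) \<Rightarrow> 'g set" where
  "supp x = {\<alpha>. x \<alpha> \<noteq> 0}"

definition direct_sum :: "('g \<Rightarrow> 'f::zero) set" where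
  "direct_sum = {x. finite (supp x)}"

definition unit_vec :: "'g \<Rightarrow> 'g \<Rightarrow> 'f::zero_neq_one" where
  "unit_vec \<beta> = (\<lambda>\<alpha>. if \<alpha> = \<beta> then 1 else 0)"

definition weighted_shift :: "('g \<Rightarrow> 'g) \<Rightarrow> ('g \<Rightarrow> 'f::times) \<Rightarrow> ('g \<Rightarrow> 'f) \<Rightarrow> ('g \<Rightarrow> 'f)" where
  "weighted_shift \<phi> w x = (\<lambda>\<alpha>. w \<alpha> * x (\<phi> \<alpha>))"

(* The map f : A -> B is of finite fibre. Only the values of f on A matter, so for a total
   function f this speaks about the restriction of f to A. *)
definition finite_fibre :: "'a set \<Rightarrow> 'b set \<Rightarrow> ('a \<Rightarrow> 'b) \<Rightarrow> bool" where
  "finite_fibre A B f \<longleftrightarrow> f ` A \<subseteq> B \<and> (\<forall>y\<in>B. finite {x \<in> A. f x = y})"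

end

theory Submission
  imports Defs
begin

text \<open>Everything is read off the support of the image: by \<open>supp_weighted_shift\<close>
  it is the union, over \<beta> in \<open>supp x\<close>, of the fibres of \<phi> restricted to
  \<open>supp w\<close>. A unit vector picks out a single fibre, and a finitely supported x gives a
  finite union of fibres.\<close>

text \<open>Without zero divisors, a product is nonzero exactly when both factors are; the indices
  \<alpha> are then sorted by the value \<phi> \<alpha>.\<close>

lemma supp_weighted_shift:
  fixes w x :: "'g \<Rightarrow> 'f::semiring_no_zero_divisors"
  shows "supp (weighted_shift \<phi> w x) = (\<Union>\<beta>\<in>supp x. {\<alpha> \<in> supp w. \<phi> \<alpha> = \<beta>})"
  by (auto simp: supp_def weighted_shift_def)

lemma supp_unit_vec: "supp (unit_vec \<beta> :: 'g \<Rightarrow> 'f::zero_neq_one) = {\<beta>}"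
  by (auto simp: supp_def unit_vec_def)

theorem lemma6p1:
  fixes \<phi> :: "'g \<Rightarrow> 'g" and w :: "'g \<Rightarrow> 'f::{field, finite}"
  shows "(weighted_shift \<phi> w ` direct_sum \<subseteq> direct_sum
            \<longleftrightarrow> (\<forall>\<beta>. weighted_shift \<phi> w (unit_vec \<beta>) \<in> direct_sum))
       \<and> ((\<forall>\<beta>. weighted_shift \<phi> w (unit_vec \<beta>) \<in> direct_sum)
            \<longleftrightarrow> finite_fibre (supp w) UNIV \<phi>)"
proof -
  \<comment> \<open>As \<open>supp (unit_vec \<beta>)\<close> is {\<beta>}, the union collapses to
    the fibre over \<beta>.\<close>
  have fibres: "(\<forall>\<beta>. weighted_shift \<phi> w (unit_vec \<beta>) \<in> direct_sum)
      \<longleftrightarrow> finite_fibre (supp w) UNIV \<phi>"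
    by (simp add: direct_sum_def finite_fibre_def supp_weighted_shift supp_unit_vec)
  have "weighted_shift \<phi> w (unit_vec \<beta>) \<in> direct_sum"
    if "weighted_shift \<phi> w ` direct_sum \<subseteq> direct_sum" for \<beta>
  proof -
    have "(unit_vec \<beta> :: 'g \<Rightarrow> 'f) \<in> direct_sum"
      by (simp add: direct_sum_def supp_unit_vec)
    with that show ?thesis by blast
  qed
  \<comment> \<open>A finite union of finite fibres is finite; this closes the cycle of
    implications.\<close>
  moreover have "weighted_shift \<phi> w ` direct_sum \<subseteq> direct_sum"
    if "finite_fibre (supp w) UNIV \<phi>"
    using that by (auto simp: direct_sum_def finite_fibre_def supp_weighted_shift)
  ultimately show ?thesis
    using fibres by blast
qed

end
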